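(* Let $\mathscr{A}$ be a unital $C^*$-algebra, let $\tau_1,\tau_2$ be states on $\mathscr{A}$, let $J\subseteq\mathbb{R}$ be an interval and let $f,g:J\to\mathbb{R}$ be synchronous functions. Then $$\tau_1\left(f(A)g(A)\right)+\tau_2\left(f(B)g(B)\right)\geq\tau_1\left(f(A)\right)\tau_2\left(g(B)\right)+\tau_2\left(f(B)\right)\tau_1\left(g(A)\right)$$ for all self-adjoint $A,B\in\mathscr{A}$ whose spectra are contained in $J$.
   Context: Two continuous functions $f,g:J\to\mathbb{R}$ are synchronous if $(f(t)-f(s))(g(t)-g(s))\ge 0$ for all $s,t\in J$. $f(A)$ denotes the continuous functional calculus. *)

theory Defs
  imports "HOL-Analysis.Analysis" "HOL-Library.Complex_Order"
begin

text \<open>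
  Nonzero unital complex C*-algebras, as a type class. The zero algebra is excluded by
  the axiom \<open>0 \<noteq> 1\<close> of \<open>real_normed_algebra_1\<close>; it has no states.
\<close>

class cstar_algebra = real_normed_algebra_1 + banach +
  fixes scaleC :: "complex \<Rightarrow> 'a \<Rightarrow> 'a"  (infixr \<open>*\<^sub>C\<close> 75)
    and star :: "'a \<Rightarrow> 'a"
  assumes scaleR_scaleC: "r *\<^sub>R x = complex_of_real r *\<^sub>C x"
    and scaleC_add_right: "c *\<^sub>C (x + y) = c *\<^sub>C x + c *\<^sub>C y"
    and scaleC_add_left: "(c + d) *\<^sub>C x = c *\<^sub>C x + d *\<^sub>C x"
    and scaleC_scaleC: "c *\<^sub>C (d *\<^sub>C x) = (c * d) *\<^sub>C x"
    and mult_scaleC_left: "(c *\<^sub>C x) * y = c *\<^sub>C (x * y)"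
    and mult_scaleC_right: "x * (c *\<^sub>C y) = c *\<^sub>C (x * y)"
    and norm_scaleC: "norm (c *\<^sub>C x) = cmod c * norm x"
    and star_star: "star (star x) = x"
    and star_add: "star (x + y) = star x + star y"
    and star_scaleC: "star (c *\<^sub>C x) = cnj c *\<^sub>C star x"
    and star_mult: "star (x * y) = star y * star x"
    and cstar_identity: "norm (star x * x) = (norm x)\<^sup>2"

instantiation complex :: cstar_algebra
begin
definition scaleC_complex :: "complex \<Rightarrow> complex \<Rightarrow> complex"
  where "scaleC_complex c x = c * x"
definition star_complex :: "complex \<Rightarrow> complex"
  where "star_complex x = cnj x"
instance
  by standard
    (auto simp: scaleC_complex_def star_complex_def scaleR_conv_of_real algebra_simps
      norm_mult power2_eq_square)
end

definition selfadjoint :: "'a::cstar_algebra \<Rightarrow> bool"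
  where "selfadjoint a \<longleftrightarrow> star a = a"

definition spectrum :: "'a::cstar_algebra \<Rightarrow> complex set"
  where "spectrum a =
    {z. \<not> (\<exists>b. (a - z *\<^sub>C 1) * b = 1 \<and> b * (a - z *\<^sub>C 1) = 1)}"

text \<open>
  States: positive linear functionals with value \<open>1\<close> at the unit. The order on \<^typ>\<open>complex\<close>
  is that of \<^theory>\<open>HOL-Library.Complex_Order\<close>: \<open>w \<le> z\<close> means that the imaginary parts agree
  and \<open>Re w \<le> Re z\<close>, so \<open>0 \<le> z\<close> says that \<open>z\<close> is real and nonnegative.
\<close>

definition state :: "('a::cstar_algebra \<Rightarrow> complex) \<Rightarrow> bool"
  where "state \<tau> \<longleftrightarrow>
    (\<forall>x y. \<tau> (x + y) = \<tau> x + \<tau> y) \<and>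
    (\<forall>c x. \<tau> (c *\<^sub>C x) = c * \<tau> x) \<and>
    (\<forall>x. 0 \<le> \<tau> (star x * x)) \<and>
    \<tau> 1 = 1"

text \<open>
  A unital *-homomorphism from \<open>C(S)\<close>, the algebra of continuous complex functions on \<open>S\<close>.
  An element of \<open>C(S)\<close> is represented by any total function whose restriction to \<open>S\<close> it is;
  the first condition makes \<open>\<Phi>\<close> independent of the representative.
\<close>

definition unital_star_hom_on ::
    "complex set \<Rightarrow> ((complex \<Rightarrow> complex) \<Rightarrow> 'a::cstar_algebra) \<Rightarrow> bool"
  where "unital_star_hom_on S \<Phi> \<longleftrightarrow>
    (\<forall>f g. continuous_on S f \<longrightarrow> continuous_on S g \<longrightarrow> (\<forall>z\<in>S. f z = g z) \<longrightarrow> \<Phi> f = \<Phi> g) \<and>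
    (\<forall>f g. continuous_on S f \<longrightarrow> continuous_on S g \<longrightarrow> \<Phi> (\<lambda>z. f z + g z) = \<Phi> f + \<Phi> g) \<and>
    (\<forall>c f. continuous_on S f \<longrightarrow> \<Phi> (\<lambda>z. c * f z) = c *\<^sub>C \<Phi> f) \<and>
    (\<forall>f g. continuous_on S f \<longrightarrow> continuous_on S g \<longrightarrow> \<Phi> (\<lambda>z. f z * g z) = \<Phi> f * \<Phi> g) \<and>
    (\<forall>f. continuous_on S f \<longrightarrow> \<Phi> (\<lambda>z. cnj (f z)) = star (\<Phi> f)) \<and>
    \<Phi> (\<lambda>z. 1) = 1"

text \<open>
  Continuous functional calculus: for normal \<open>a\<close> there is exactly one unital *-homomorphism
  from \<open>C(spectrum a)\<close> sending the identity function to \<open>a\<close>, and \<open>f(a)\<close> is the image of \<open>f\<close>.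
  The value is meaningful only for normal \<open>a\<close> and \<open>f\<close> continuous on the spectrum.
\<close>

definition cfc :: "(complex \<Rightarrow> complex) \<Rightarrow> 'a::cstar_algebra \<Rightarrow> 'a"
  where "cfc f a =
    (THE x. \<exists>\<Phi>. unital_star_hom_on (spectrum a) \<Phi> \<and> \<Phi> (\<lambda>z. z) = a \<and> \<Phi> f = x)"

text \<open>
  For self-adjoint \<open>a\<close> the spectrum is real, and a real function \<open>f\<close> is viewed as the
  function \<open>z \<mapsto> f (Re z)\<close> on it.
\<close>

definition real_cfc :: "(real \<Rightarrow> real) \<Rightarrow> 'a::cstar_algebra \<Rightarrow> 'a"
  where "real_cfc f a = cfc (\<lambda>z. complex_of_real (f (Re z))) a"

definition synchronous_on :: "real set \<Rightarrow> (real \<Rightarrow> real) \<Rightarrow> (real \<Rightarrow> real) \<Rightarrow> bool"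
  where "synchronous_on J f g \<longleftrightarrow>
    continuous_on J f \<and> continuous_on J g \<and>
    (\<forall>t\<in>J. \<forall>s\<in>J. (f t - f s) * (g t - g s) \<ge> 0)"

end

theory Submission
  imports Defs "HOL-Computational_Algebra.Fundamental_Theorem_Algebra"
begin

text \<open>
  For a fixed \<open>s \<in> J\<close>, synchronicity says that \<open>(f - f s) (g - g s) \<ge> 0\<close> on the spectrum of \<open>A\<close>;
  applying \<open>\<tau>\<^sub>1\<close> to the functional calculus of \<open>A\<close> turns this into an inequality between real
  functions of \<open>s\<close>, to which \<open>\<tau>\<^sub>2\<close> and the functional calculus of \<open>B\<close> are applied in turn.
  The functional calculus is the closure of the polynomial one; both its existence and its
  uniqueness rest on the fact that the norm of a self-adjoint element is at most its spectral
  radius. This is obtained without complex function theory, by averaging resolvents over the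
  \<open>2\<^sup>k\<close>-th roots of unity.
\<close>

subsection \<open>Spectrum and norm of self-adjoint elements\<close>

lemma scaleC_zero_left [simp]: "0 *\<^sub>C x = (0::'a::cstar_algebra)"
  using scaleC_add_left [of 0 0 x] by simp

lemma scaleC_zero_right [simp]: "c *\<^sub>C 0 = (0::'a::cstar_algebra)"
  using scaleC_add_right [of c 0 0] by simp

lemma scaleC_one [simp]: "1 *\<^sub>C x = (x::'a::cstar_algebra)"
  using scaleR_scaleC [of 1 x] by simp

lemma scaleC_minus_left [simp]: "(- c) *\<^sub>C x = - (c *\<^sub>C (x::'a::cstar_algebra))"
  using scaleC_add_left [of c "- c" x] by (simp add: eq_neg_iff_add_eq_0 add.commute)

lemma scaleC_minus_right: "c *\<^sub>C (- x) = - (c *\<^sub>C (x::'a::cstar_algebra))"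
  using scaleC_add_right [of c x "- x"] by (simp add: eq_neg_iff_add_eq_0 add.commute)

lemma scaleC_diff_left: "(c - d) *\<^sub>C x = c *\<^sub>C x - d *\<^sub>C (x::'a::cstar_algebra)"
  using scaleC_add_left [of c "- d" x] by simp

lemma scaleC_diff_right: "c *\<^sub>C (x - y) = c *\<^sub>C x - c *\<^sub>C (y::'a::cstar_algebra)"
  using scaleC_add_right [of c x "- y"] by (simp add: scaleC_minus_right)

lemma bounded_linear_scaleC: "bounded_linear (\<lambda>x. c *\<^sub>C (x::'a::cstar_algebra))"
  by (rule bounded_linear_intro [of _ "cmod c"])
    (simp_all add: scaleC_add_right scaleR_scaleC scaleC_scaleC norm_scaleC mult.commute)

lemma star_zero [simp]: "star 0 = (0::'a::cstar_algebra)"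
  using star_scaleC [of 0 0] by simp

lemma star_one [simp]: "star 1 = (1::'a::cstar_algebra)"
  by (metis mult.left_neutral mult.right_neutral star_mult star_star)

lemma star_power: "star (x ^ n) = star (x::'a::cstar_algebra) ^ n"
  by (induction n) (auto simp: star_mult power_commutes)

text \<open>The C*-identity and submultiplicativity bound \<open>(norm y)\<^sup>2\<close> by
  \<open>norm (star y) * norm y\<close>; cancel \<open>norm y\<close>, then use this at both
  \<open>x\<close> and \<open>star x\<close>.\<close>

lemma norm_star [simp]: "norm (star x) = norm (x::'a::cstar_algebra)"
proof -
  have *: "norm y \<le> norm (star y)" for y :: 'a
  proof (cases "y = 0")
    case False
    have "norm y * norm y \<le> norm (star y) * norm y"
      using cstar_identity [of y] norm_mult_ineq [of "star y" y] by (simp add: power2_eq_square)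
    then show ?thesis using False by simp
  qed simp
  show ?thesis using * [of x] * [of "star x"] by (simp add: star_star)
qed

lemma bounded_linear_star: "bounded_linear (star :: 'a::cstar_algebra \<Rightarrow> 'a)"
  by (rule bounded_linear_intro [of _ 1]) (simp_all add: star_add scaleR_scaleC star_scaleC)

text \<open>For self-adjoint \<open>u\<close> the C*-identity reads
  \<open>norm (u * u) = (norm u)\<^sup>2\<close>, so repeated squaring loses no norm. Hence the
  restriction to exponents that are powers of two.\<close>

lemma norm_power_two_selfadjoint:
  fixes x :: "'a::cstar_algebra"
  assumes "selfadjoint x"
  shows "norm (x ^ (2 ^ k)) = norm x ^ (2 ^ k)"
proof (induction k)
  case (Suc k)
  have "star (x ^ 2 ^ k) = x ^ 2 ^ k"
    using assms by (simp add: selfadjoint_def star_power)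
  then show ?case
    using cstar_identity [of "x ^ 2 ^ k"] Suc
    by (simp add: power_add [symmetric] power_mult [symmetric] mult.commute flip: mult_2)
qed simp

section \<open>Inverses, the Neumann series and compactness of the spectrum\<close>

definition mutual_inverse :: "'a::monoid_mult \<Rightarrow> 'a \<Rightarrow> bool"
  where "mutual_inverse u v \<longleftrightarrow> u * v = 1 \<and> v * u = 1"

lemma notin_spectrum_iff: "z \<notin> spectrum a \<longleftrightarrow> (\<exists>b. mutual_inverse (a - z *\<^sub>C 1) b)"
  by (auto simp: spectrum_def mutual_inverse_def)

lemma mutual_inverse_scaleC:
  fixes u v :: "'a::cstar_algebra"
  assumes "mutual_inverse u v" "c \<noteq> 0"
  shows "mutual_inverse (c *\<^sub>C u) ((1 / c) *\<^sub>C v)"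
  using assms by (simp add: mutual_inverse_def mult_scaleC_left mult_scaleC_right scaleC_scaleC)

lemma mutual_inverse_mult:
  assumes "mutual_inverse u v" "mutual_inverse u' v'"
  shows "mutual_inverse (u * u') (v' * v)"
  using assms unfolding mutual_inverse_def by (metis mult.assoc mult.right_neutral)

text \<open>The resolvent identity: after expanding, \<open>q * v\<close> and \<open>u * p\<close>
  collapse to 1.\<close>

lemma mutual_inverse_diff:
  fixes u v p q :: "'a::ring_1"
  assumes "mutual_inverse u p" "mutual_inverse v q"
  shows "p - q = q * (v - u) * p"
proof -
  have "q * (v - u) * p = (q * v) * p - q * (u * p)"
    by (simp add: algebra_simps)
  then show ?thesis using assms by (simp add: mutual_inverse_def)
qed

lemma mutual_inverse_Neumann:
  fixes x :: "'a::{real_normed_algebra_1,banach}"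
  assumes "norm x < 1"
  shows "mutual_inverse (1 - x) (\<Sum>n. x ^ n)"
proof -
  have s: "summable (\<lambda>n. x ^ n)"
    using assms by (rule complete_algebra_summable_geometric)
  have split: "(\<Sum>n. x ^ n) = 1 + (\<Sum>n. x ^ Suc n)"
    using suminf_split_head [OF s] by simp
  have "(\<Sum>n. x ^ Suc n) = x * (\<Sum>n. x ^ n)"
    using suminf_mult [OF s, of x] by simp
  moreover have "(\<Sum>n. x ^ Suc n) = (\<Sum>n. x ^ n) * x"
    using suminf_mult2 [OF s, of x] by (simp add: power_commutes)
  ultimately show ?thesis using split
    by (simp add: mutual_inverse_def algebra_simps)
qed

text \<open>If \<open>cmod z\<close> exceeds \<open>norm a\<close>, then \<open>a - z\<close> is
  \<open>- z\<close> times \<open>1 - a / z\<close>, which the Neumann series inverts.\<close>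

lemma spectrum_bounded:
  assumes "z \<in> spectrum a"
  shows "cmod z \<le> norm a"
proof (rule ccontr)
  assume *: "\<not> cmod z \<le> norm a"
  then have z: "z \<noteq> 0" by auto
  have "norm ((1 / z) *\<^sub>C a) < 1"
    using * z by (simp add: norm_scaleC norm_divide divide_simps)
  from mutual_inverse_scaleC [OF mutual_inverse_Neumann [OF this], of "- z"] z
  show False using assms
    by (simp add: scaleC_diff_right scaleC_scaleC)
       (metis notin_spectrum_iff)
qed

lemma closed_spectrum: "closed (spectrum a)"
proof -
  have "open (- spectrum a)"
    unfolding open_dist
  proof (intro ballI)
    fix z assume "z \<in> - spectrum a"
    then obtain b where b: "mutual_inverse (a - z *\<^sub>C 1) b"
      by (auto simp: notin_spectrum_iff)
    then have "b \<noteq> 0" by (auto simp: mutual_inverse_def)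
    show "\<exists>e>0. \<forall>w. dist w z < e \<longrightarrow> w \<in> - spectrum a"
    proof (intro exI conjI allI impI)
      \<comment> \<open>With this radius \<open>(w - z) *\<^sub>C b\<close> has norm below 1, and
        \<open>a - w\<close> factors as \<open>a - z\<close> times the Neumann-invertible
        \<open>1 - (w - z) b\<close>.\<close>
      show "0 < 1 / norm b" using \<open>b \<noteq> 0\<close> by simp
      fix w assume "dist w z < 1 / norm b"
      then have "norm ((w - z) *\<^sub>C b) < 1"
        using \<open>b \<noteq> 0\<close> by (simp add: norm_scaleC dist_norm divide_simps)
      from mutual_inverse_mult [OF b mutual_inverse_Neumann [OF this]]
      have "\<exists>b'. mutual_inverse ((a - z *\<^sub>C 1) * (1 - (w - z) *\<^sub>C b)) b'" ..
      moreover have "(a - z *\<^sub>C 1) * (1 - (w - z) *\<^sub>C b) = a - w *\<^sub>C 1"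
        using b by (simp add: mutual_inverse_def right_diff_distrib mult_scaleC_right scaleC_diff_left)
      ultimately show "w \<in> - spectrum a"
        by (simp add: notin_spectrum_iff)
    qed
  qed
  then show ?thesis by (simp add: closed_def)
qed

lemma compact_spectrum: "compact (spectrum a)"
  using closed_spectrum spectrum_bounded
  by (auto simp: compact_eq_bounded_closed bounded_iff)

section \<open>The norm of a self-adjoint element is at most its spectral radius\<close>

text \<open>Partial fractions: multiplying \<open>p\<close> and \<open>q\<close> by
  \<open>1 - w * w\<close> leaves \<open>1 + w\<close> and \<open>1 - w\<close>, whose sum is 2.
  This is the passage from a power of \<open>y\<close> to its square.\<close>

lemma mutual_inverse_average:
  fixes w p q :: "'a::real_algebra_1"
  assumes "mutual_inverse (1 - w) p" "mutual_inverse (1 + w) q"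
  shows "mutual_inverse (1 - w * w) ((1/2) *\<^sub>R (p + q))"
proof -
  have f: "1 - w * w = (1 + w) * (1 - w)" "1 - w * w = (1 - w) * (1 + w)"
    by (simp_all add: algebra_simps)
  have a: "(1 - w * w) * p = 1 + w" "(1 - w * w) * q = 1 - w"
    using assms f unfolding mutual_inverse_def by (metis mult.assoc mult.right_neutral)+
  have b: "p * (1 - w * w) = 1 + w" "q * (1 - w * w) = 1 - w"
    using assms f unfolding mutual_inverse_def by (metis mult.assoc mult.left_neutral)+
  show ?thesis
    unfolding mutual_inverse_def mult_scaleR_right mult_scaleR_left
      distrib_left [of "1 - w * w"] distrib_right [of p q] a b
    by (simp add: scaleR_2 [symmetric])
qed

lemma resolvent_continuous:
  fixes y :: "'a::cstar_algebra"
  assumes inv: "\<And>l. l \<in> D \<Longrightarrow> mutual_inverse (1 - l *\<^sub>C y) (R l)"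
  shows "continuous_on D R"
proof -
  have id: "R l - R m = (l - m) *\<^sub>C (R m * y * R l)" if "l \<in> D" "m \<in> D" for l m
    using mutual_inverse_diff [OF inv [OF that(1)] inv [OF that(2)]]
    by (simp add: scaleC_diff_left [symmetric] mult_scaleC_left mult_scaleC_right)
  show ?thesis
    unfolding continuous_on_iff
  proof (intro ballI allI impI)
    fix m e assume m: "m \<in> D" and e: "0 < (e::real)"
    \<comment> \<open>The added 1 keeps both constants positive. Closeness measured by
      \<open>K\<close> gives \<open>norm (R l) \<le> 2 * norm (R m)\<close>; with that bound the
      resolvent identity makes the difference at most \<open>cmod (l - m) * L\<close>.\<close>
    define K where "K = norm (R m) * norm y + 1"
    define L where "L = 2 * norm (R m) * K + 1"
    have K: "K > 0" "norm (R m) * norm y \<le> K" and L: "L > 0"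
      by (auto simp: K_def L_def intro!: add_nonneg_pos)
    show "\<exists>d>0. \<forall>l\<in>D. dist l m < d \<longrightarrow> dist (R l) (R m) < e"
    proof (intro exI conjI ballI impI)
      show "0 < min (1 / (2 * K)) (e / L)" using K L e by simp
      fix l assume l: "l \<in> D" "dist l m < min (1 / (2 * K)) (e / L)"
      then have d: "cmod (l - m) * K < 1 / 2" "cmod (l - m) * L < e"
        using K L by (simp_all add: dist_norm field_simps)
      have "norm (R l - R m) = cmod (l - m) * norm (R m * y * R l)"
        using id [OF l(1) m] by (simp add: norm_scaleC)
      also have "norm (R m * y * R l) \<le> norm (R m) * norm y * norm (R l)"
        by (meson mult_right_mono norm_ge_zero norm_mult_ineq order_trans)
      also have "\<dots> \<le> K * norm (R l)" using K by (intro mult_right_mono) auto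
      finally have n: "norm (R l - R m) \<le> cmod (l - m) * K * norm (R l)"
        by (simp add: mult_left_mono mult.assoc)
      also have "\<dots> \<le> 1 / 2 * norm (R l)" using d by (intro mult_right_mono) auto
      finally have "norm (R l) \<le> 2 * norm (R m)"
        using norm_triangle_ineq2 [of "R l" "R m"] by linarith
      then have "cmod (l - m) * K * norm (R l) \<le> cmod (l - m) * K * (2 * norm (R m))"
        using K by (intro mult_left_mono) auto
      also have "\<dots> \<le> cmod (l - m) * L"
        by (simp add: L_def algebra_simps)
      finally show "dist (R l) (R m) < e" using n d by (simp add: dist_norm)
    qed
  qed
qed

text \<open>
  Otherwise the resolvent \<open>R l\<close> is bounded on the closed unit disc, so \<open>R m\<close> and \<open>R (t m)\<close> are
  uniformly close for \<open>cmod m = 1\<close> and \<open>t\<close> near \<open>1\<close>. Since \<open>(1 - w\<^sup>2)\<^sup>-\<^sup>1\<close> is the average of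
  \<open>(1 - w)\<^sup>-\<^sup>1\<close> and \<open>(1 + w)\<^sup>-\<^sup>1\<close>, the same bound holds between the inverses of \<open>1 - y\<^sup>n\<close> and
  \<open>1 - (t y)\<^sup>n\<close> for every power \<open>n\<close> of two. The latter tends to \<open>1\<close>, which forces \<open>norm (y\<^sup>n) < 1\<close>.
\<close>

lemma selfadjoint_unit_not_invertible:
  fixes y :: "'a::cstar_algebra"
  assumes sa: "selfadjoint y" and y: "norm y = 1"
  shows "\<exists>l. cmod l \<le> 1 \<and> (\<nexists>b. mutual_inverse (1 - l *\<^sub>C y) b)"
proof (rule ccontr)
  assume "\<not> ?thesis"
  then have "\<forall>l\<in>cball 0 1. \<exists>b. mutual_inverse (1 - l *\<^sub>C y) b"
    by auto
  then obtain R where R: "\<And>l. l \<in> cball 0 1 \<Longrightarrow> mutual_inverse (1 - l *\<^sub>C y) (R l)"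
    by metis
  then have "compact (R ` cball 0 1)"
    by (intro compact_continuous_image resolvent_continuous [OF R]) auto
  then obtain M where M: "M > 0" "\<And>l. cmod l \<le> 1 \<Longrightarrow> norm (R l) \<le> M"
    by (auto simp: bounded_pos dest!: compact_imp_bounded)
  \<comment> \<open>The second entry makes \<open>(1 - t) * M\<^sup>2\<close> at most 1/8; the first
    keeps \<open>t\<close> positive.\<close>
  define t where "t = 1 - min (1 / 2) (1 / (8 * M\<^sup>2))"
  have t: "0 < t" "t < 1" using M by (auto simp: t_def min_def)
  have "1 - t \<le> 1 / (8 * M\<^sup>2)" by (simp add: t_def)
  then have tM: "(1 - t) * M\<^sup>2 \<le> 1 / 8" using M by (simp add: field_simps)
  \<comment> \<open>The induction needs every \<open>m\<close> on the unit circle, since the step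
    for \<open>m\<close> uses the hypothesis at both of its square roots. Averaging two differences
    preserves the bound 1/8, so it is independent of \<open>k\<close>.\<close>
  have step: "\<exists>U V. mutual_inverse (1 - m *\<^sub>C y ^ 2 ^ k) U \<and>
      mutual_inverse (1 - (m * of_real (t ^ 2 ^ k)) *\<^sub>C y ^ 2 ^ k) V \<and> norm (U - V) \<le> 1 / 8"
    if "cmod m = 1" for m k
    using that
  proof (induction k arbitrary: m)
    case 0
    have c: "m \<in> cball 0 1" "m * of_real t \<in> cball 0 1"
      using 0 t by (auto simp: norm_mult)
    note I = R [OF c(1)] R [OF c(2)]
    have "R m - R (m * t) = R (m * t) * ((1 - (m * t) *\<^sub>C y) - (1 - m *\<^sub>C y)) * R m"
      by (rule mutual_inverse_diff [OF I])
    also have "(1 - (m * t) *\<^sub>C y) - (1 - m *\<^sub>C y) = (m * of_real (1 - t)) *\<^sub>C y"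
      by (simp add: scaleC_diff_left [symmetric] algebra_simps)
    also have "norm (R (m * t) * \<dots> * R m) \<le> norm (R (m * t)) * norm ((m * of_real (1 - t)) *\<^sub>C y) * norm (R m)"
      by (meson mult_right_mono norm_ge_zero norm_mult_ineq order_trans)
    also have "\<dots> = (1 - t) * (norm (R m) * norm (R (m * t)))"
      using 0 t y by (simp add: norm_scaleC norm_mult del: of_real_diff)
    also have "norm (R m) * norm (R (m * t)) \<le> M\<^sup>2"
      unfolding power2_eq_square using c M by (intro mult_mono) auto
    then have "(1 - t) * (norm (R m) * norm (R (m * t))) \<le> (1 - t) * M\<^sup>2"
      using t by (intro mult_left_mono) auto
    finally show ?case using I tM by fastforce
  next
    case (Suc k)
    let ?n = "csqrt m"
    have n: "?n * ?n = m" by (metis power2_csqrt power2_eq_square)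
    have nn: "cmod ?n = 1" "cmod (- ?n) = 1"
      using Suc.prems by (simp_all add: norm_csqrt)
    obtain U V where UV: "mutual_inverse (1 - ?n *\<^sub>C y ^ 2 ^ k) U"
      "mutual_inverse (1 - (?n * of_real (t ^ 2 ^ k)) *\<^sub>C y ^ 2 ^ k) V" "norm (U - V) \<le> 1 / 8"
      using Suc.IH [OF nn(1)] by blast
    obtain U' V' where UV': "mutual_inverse (1 + ?n *\<^sub>C y ^ 2 ^ k) U'"
      "mutual_inverse (1 + (?n * of_real (t ^ 2 ^ k)) *\<^sub>C y ^ 2 ^ k) V'" "norm (U' - V') \<le> 1 / 8"
      using Suc.IH [OF nn(2)] by auto
    have p: "x ^ 2 ^ k * x ^ 2 ^ k = x ^ 2 ^ Suc k" for x :: "'b::monoid_mult"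
      by (simp add: mult_2 flip: power_add)
    have e1: "(?n *\<^sub>C y ^ 2 ^ k) * (?n *\<^sub>C y ^ 2 ^ k) = m *\<^sub>C y ^ 2 ^ Suc k"
      by (simp only: mult_scaleC_left mult_scaleC_right scaleC_scaleC p n)
    have "?n * of_real (t ^ 2 ^ k) * (?n * of_real (t ^ 2 ^ k)) =
        (?n * ?n) * of_real (t ^ 2 ^ k * t ^ 2 ^ k)"
      by (simp only: of_real_mult ac_simps)
    also have "\<dots> = m * of_real (t ^ 2 ^ Suc k)"
      by (simp only: n p)
    finally have "?n * of_real (t ^ 2 ^ k) * (?n * of_real (t ^ 2 ^ k)) = m * of_real (t ^ 2 ^ Suc k)" .
    then have e2: "((?n * of_real (t ^ 2 ^ k)) *\<^sub>C y ^ 2 ^ k) * ((?n * of_real (t ^ 2 ^ k)) *\<^sub>C y ^ 2 ^ k)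
        = (m * of_real (t ^ 2 ^ Suc k)) *\<^sub>C y ^ 2 ^ Suc k"
      by (simp only: mult_scaleC_left mult_scaleC_right scaleC_scaleC p)
    have "(1/2) *\<^sub>R (U + U') - (1/2) *\<^sub>R (V + V') = (1/2) *\<^sub>R ((U - V) + (U' - V'))"
      by (simp add: scaleR_diff_right scaleR_add_right)
    then have "norm ((1/2) *\<^sub>R (U + U') - (1/2) *\<^sub>R (V + V')) = norm ((U - V) + (U' - V')) / 2"
      by simp
    also have "\<dots> \<le> 1 / 8"
      using norm_triangle_ineq [of "U - V" "U' - V'"] UV UV' by simp
    finally show ?case
      using mutual_inverse_average [OF UV(1) UV'(1), unfolded e1]
        mutual_inverse_average [OF UV(2) UV'(2), unfolded e2] by blast
  qed
  \<comment> \<open>The constant 1/9 is chosen because \<open>v \<le> (1 + v) / 9\<close> gives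
    \<open>v \<le> 1 / 8\<close>, to be used with \<open>v = norm (V - 1)\<close>. The exponent
    \<open>2 ^ N\<close> is at least \<open>N\<close>.\<close>
  have "(\<lambda>n. t ^ n) \<longlonglongrightarrow> 0" using t by (intro LIMSEQ_realpow_zero) auto
  then have "\<forall>\<^sub>F n in sequentially. t ^ n < 1 / 9" by (rule order_tendstoD) simp
  then obtain N where N: "\<And>n. n \<ge> N \<Longrightarrow> t ^ n < 1 / 9" by (auto simp: eventually_sequentially)
  let ?n = "(2::nat) ^ N"
  obtain U V where U: "mutual_inverse (1 - y ^ ?n) U"
    and V: "mutual_inverse (1 - of_real (t ^ ?n) *\<^sub>C y ^ ?n) V" and UV: "norm (U - V) \<le> 1 / 8"
    using step [of 1 N] by (simp only: norm_one scaleC_one mult_1_left) blast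
  have c: "norm (y ^ ?n) = 1" using norm_power_two_selfadjoint [OF sa] y by simp
  have t9: "t ^ ?n \<le> 1 / 9" using N [of ?n] by (simp add: less_imp_le)
  have "V - (of_real (t ^ ?n) *\<^sub>C y ^ ?n) * V = 1"
    using V unfolding mutual_inverse_def left_diff_distrib by simp
  moreover have "a - b = c \<Longrightarrow> a - c = b" for a b c :: 'a
    by auto
  ultimately have "V - 1 = (of_real (t ^ ?n) *\<^sub>C y ^ ?n) * V"
    by blast
  then have "norm (V - 1) \<le> t ^ ?n * norm V"
    using norm_mult_ineq [of "of_real (t ^ ?n) *\<^sub>C y ^ ?n" V] c t by (simp add: norm_scaleC norm_power)
  also have "\<dots> \<le> 1 / 9 * norm V" using t9 by (intro mult_right_mono) auto
  finally have "norm (V - 1) \<le> 1 / 8"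
    using norm_triangle_ineq [of 1 "V - 1"] by simp
  then have U1: "norm (U - 1) \<le> 1 / 4"
    using norm_triangle_ineq [of "U - V" "V - 1"] UV by simp
  \<comment> \<open>The left side has norm 1 by the C*-identity, the factors have norms at most 1/4
    and 2.\<close>
  have "y ^ ?n = (U - 1) * (1 - y ^ ?n)"
    using U by (simp add: mutual_inverse_def left_diff_distrib)
  then have "1 \<le> norm (U - 1) * norm (1 - y ^ ?n)"
    using c norm_mult_ineq by metis
  also have "\<dots> \<le> 1 / 4 * 2"
    using U1 c norm_triangle_ineq4 [of 1 "y ^ ?n"] by (intro mult_mono) auto
  finally show False by simp
qed

text \<open>Normalising \<open>x\<close> to norm one yields a nonzero \<open>l\<close> in the closed
  unit disc with \<open>1 - l y\<close> not invertible; then \<open>norm x / l\<close> is a spectral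
  value of modulus at least \<open>norm x\<close>.\<close>

lemma norm_le_spectral_bound:
  fixes x :: "'a::cstar_algebra"
  assumes sa: "selfadjoint x" and sp: "\<And>z. z \<in> spectrum x \<Longrightarrow> cmod z \<le> r" and r: "0 \<le> r"
  shows "norm x \<le> r"
proof (rule ccontr)
  assume n: "\<not> norm x \<le> r"
  then have x: "norm x > 0" using r by linarith
  let ?y = "of_real (1 / norm x) *\<^sub>C x"
  have "selfadjoint ?y" "norm ?y = 1"
    using sa x by (auto simp: selfadjoint_def star_scaleC norm_scaleC norm_divide)
  then obtain l where l: "cmod l \<le> 1" "\<nexists>b. mutual_inverse (1 - l *\<^sub>C ?y) b"
    using selfadjoint_unit_not_invertible by blast
  have "l \<noteq> 0"
  proof
    assume "l = 0"
    then have "mutual_inverse (1 - l *\<^sub>C ?y) 1" by (simp add: mutual_inverse_def)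
    then show False using l by blast
  qed
  let ?z = "of_real (norm x) / l"
  have "norm x \<le> cmod ?z"
    using l \<open>l \<noteq> 0\<close> by (simp add: norm_divide divide_simps mult_left_le)
  then have "?z \<notin> spectrum x" using sp n by force
  then obtain b where "mutual_inverse (x - ?z *\<^sub>C 1) b" by (auto simp: notin_spectrum_iff)
  from mutual_inverse_scaleC [OF this, of "- l / of_real (norm x)"] x \<open>l \<noteq> 0\<close>
  have "\<exists>b. mutual_inverse (1 - l *\<^sub>C ?y) b"
    by (simp add: scaleC_diff_right scaleC_scaleC) blast
  then show False using l by blast
qed

text \<open>Over an empty spectrum the bound holds vacuously with \<open>r = 0\<close>, so
  \<open>x = 0\<close>; but 0 lies in the spectrum of 0.\<close>

lemma spectrum_nonempty:
  fixes x :: "'a::cstar_algebra"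
  assumes "selfadjoint x"
  shows "spectrum x \<noteq> {}"
proof
  assume e: "spectrum x = {}"
  then have "norm x \<le> 0" using norm_le_spectral_bound [OF assms, of 0] by simp
  then have "0 \<in> spectrum x" by (simp add: spectrum_def)
  then show False using e by simp
qed

subsection \<open>Continuous functional calculus\<close>

text \<open>Horner's scheme, with complex coefficients entering as multiples of the unit.\<close>

definition peval :: "complex poly \<Rightarrow> 'a::cstar_algebra \<Rightarrow> 'a"
  where "peval p a = fold_coeffs (\<lambda>c x. c *\<^sub>C 1 + a * x) p 0"

lemma peval_0 [simp]: "peval 0 a = 0"
  by (simp add: peval_def)

lemma peval_pCons [simp]: "peval (pCons c p) a = c *\<^sub>C 1 + a * peval p a"
  by (cases "p = 0 \<and> c = 0") (auto simp: peval_def)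

lemma peval_1 [simp]: "peval 1 a = 1"
  by (simp add: one_pCons)

lemma peval_add [simp]: "peval (p + q) a = peval p a + peval q a"
  by (induction p q rule: poly_induct2) (simp_all add: scaleC_add_left algebra_simps)

lemma peval_smult [simp]: "peval (smult c p) a = c *\<^sub>C peval p a"
  by (induction p) (simp_all add: scaleC_add_right scaleC_scaleC mult_scaleC_right)

lemma peval_diff [simp]: "peval (p - q) a = peval p a - peval q a"
  using peval_add [of "p - q" q a] by (simp add: algebra_simps)

lemma peval_mult [simp]: "peval (p * q) a = peval p a * peval q a"
  by (induction p) (simp_all add: mult_scaleC_left distrib_right mult.assoc)

lemma star_peval:
  assumes "selfadjoint a"
  shows "star (peval p a) = peval (map_poly cnj p) a"
proof (induction p)
  case (pCons c p)
  \<comment> \<open>Star reverses products, so \<open>a\<close> has to commute with its polynomials;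
    this is inherited from the commutative polynomial ring.\<close>
  have "peval q a * a = a * peval q a" for q
    using peval_mult [of q "[:0, 1:]" a] peval_mult [of "[:0, 1:]" q a] by (simp add: mult.commute)
  then show ?case
    using pCons assms by (simp add: map_poly_pCons star_add star_scaleC star_mult selfadjoint_def)
qed simp

lemma poly_map_poly_cnj: "z \<in> \<real> \<Longrightarrow> poly (map_poly cnj p) z = cnj (poly p z)"
  by (metis Reals_cnj_iff poly_cnj)

lemma poly_add_fun: "poly (p + q) = (\<lambda>x. poly p x + poly q x)"
  and poly_diff_fun: "poly (p - q) = (\<lambda>x. poly p x - poly q x)"
  and poly_mult_fun: "poly (p * q) = (\<lambda>x. poly p x * poly q x)"
  and poly_smult_fun: "poly (smult c p) = (\<lambda>x. c * poly p x)"
  for p q :: "'a::comm_ring poly"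
  by (simp_all add: fun_eq_iff)

text \<open>By the fundamental theorem of algebra \<open>p\<close> splits into linear factors, and
  each \<open>a - r\<close> with \<open>r\<close> a root is invertible.\<close>

lemma peval_invertible:
  assumes "p \<noteq> 0" and "\<And>z. poly p z = 0 \<Longrightarrow> z \<notin> spectrum a"
  shows "\<exists>b. mutual_inverse (peval p a) b"
  using assms
proof (induction "degree p" arbitrary: p)
  case 0
  then obtain c where c: "p = [:c:]" "c \<noteq> 0" by (metis degree_eq_zeroE pCons_0_0)
  then have "mutual_inverse (peval p a) ((1 / c) *\<^sub>C 1)"
    using mutual_inverse_scaleC [of 1 1 c] by (simp add: mutual_inverse_def)
  then show ?case ..
next
  case (Suc n)
  then obtain r where r: "poly p r = 0"
    using fundamental_theorem_of_algebra [of p] by (metis constant_degree nat.distinct(1))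
  then obtain q where q: "p = [:- r, 1:] * q" by (metis dvdE poly_eq_0_iff_dvd)
  then have "q \<noteq> 0" using Suc.prems by auto
  then have "degree p = Suc (degree q)" unfolding q by (subst degree_mult_eq) auto
  then obtain b where b: "mutual_inverse (peval q a) b"
    using Suc q \<open>q \<noteq> 0\<close> by auto
  obtain b' where "mutual_inverse (a - r *\<^sub>C 1) b'"
    using Suc.prems(2) r by (auto simp: notin_spectrum_iff)
  from mutual_inverse_mult [OF this b]
  have "mutual_inverse (peval p a) (b * b')"
    by (simp add: q del: mult_pCons_left)
  then show ?case ..
qed

text \<open>Half of the spectral mapping theorem, from inverting \<open>p - z\<close> at
  \<open>a\<close>. A spectral point of \<open>a\<close> shows that \<open>p - z\<close> is not the
  zero polynomial.\<close>

lemma spectrum_peval: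
  assumes "spectrum a \<noteq> {}" "z \<in> spectrum (peval p a)"
  shows "z \<in> poly p ` spectrum a"
proof (rule ccontr)
  assume n: "z \<notin> poly p ` spectrum a"
  have "poly (p - [:z:]) w = 0 \<Longrightarrow> w \<notin> spectrum a" for w
    using n by auto
  moreover from this have "p - [:z:] \<noteq> 0" using assms(1) by fastforce
  ultimately have "\<exists>b. mutual_inverse (peval (p - [:z:]) a) b"
    using peval_invertible by blast
  then show False using assms(2) by (simp add: notin_spectrum_iff [symmetric])
qed

text \<open>\<open>peval p a\<close> need not be self-adjoint, but its star times itself is, and
  this is the value of a polynomial equal to the squared modulus of \<open>p\<close> on the real
  spectrum. The C*-identity then takes the square root of the bound.\<close>

lemma norm_peval_le:
  fixes a :: "'a::cstar_algebra"
  assumes sa: "selfadjoint a" and re: "spectrum a \<subseteq> \<real>"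
    and r: "\<And>z. z \<in> spectrum a \<Longrightarrow> cmod (poly p z) \<le> r"
  shows "norm (peval p a) \<le> r"
proof -
  obtain z0 where "z0 \<in> spectrum a" using spectrum_nonempty [OF sa] by blast
  then have r0: "0 \<le> r" using r norm_ge_zero order_trans by blast
  let ?q = "map_poly cnj p * p"
  have q: "peval ?q a = star (peval p a) * peval p a"
    using star_peval [OF sa] by simp
  have "norm (peval ?q a) \<le> r\<^sup>2"
  proof (rule norm_le_spectral_bound)
    show "selfadjoint (peval ?q a)" by (simp only: q selfadjoint_def star_mult star_star)
    fix z assume "z \<in> spectrum (peval ?q a)"
    then obtain w where w: "w \<in> spectrum a" "z = poly ?q w"
      using spectrum_peval spectrum_nonempty [OF sa] by blast
    have "poly (map_poly cnj p) w = cnj (poly p w)"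
      using re w(1) by (intro poly_map_poly_cnj) auto
    then have "cmod z = (cmod (poly p w))\<^sup>2"
      by (simp only: w(2) poly_mult norm_mult complex_mod_cnj power2_eq_square)
    also have "\<dots> \<le> r\<^sup>2" using r [OF w(1)] by (intro power_mono) auto
    finally show "cmod z \<le> r\<^sup>2" .
  qed simp
  then show ?thesis
    using r0 unfolding q cstar_identity by (simp add: power2_le_iff_abs_le)
qed

section \<open>The continuous calculus as a limit of the polynomial one\<close>

text \<open>A relation, so that uniqueness and existence of the value can be proved
  separately.\<close>

definition calculus_graph :: "'a::cstar_algebra \<Rightarrow> (complex \<Rightarrow> complex) \<Rightarrow> 'a \<Rightarrow> bool"
  where "calculus_graph a f x \<longleftrightarrow>
    (\<exists>p. uniform_limit (spectrum a) (\<lambda>n. poly (p n)) f sequentially \<and> (\<lambda>n. peval (p n) a) \<longlonglongrightarrow> x)"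

text \<open>The difference of two approximating sequences tends to 0 uniformly on the spectrum,
  hence by \<open>norm_peval_le\<close> also in norm at \<open>a\<close>.\<close>

lemma calculus_graph_unique:
  assumes "selfadjoint a" "spectrum a \<subseteq> \<real>"
    and "calculus_graph a f x" "calculus_graph a f y"
  shows "x = y"
proof -
  obtain p q where
    p: "uniform_limit (spectrum a) (\<lambda>n. poly (p n)) f sequentially" "(\<lambda>n. peval (p n) a) \<longlonglongrightarrow> x" and
    q: "uniform_limit (spectrum a) (\<lambda>n. poly (q n)) f sequentially" "(\<lambda>n. peval (q n) a) \<longlonglongrightarrow> y"
    using assms by (auto simp: calculus_graph_def)
  have u: "uniform_limit (spectrum a) (\<lambda>n. poly (p n - q n)) (\<lambda>_. 0) sequentially"
    using uniform_limit_minus [OF p(1) q(1)] by (simp add: poly_diff_fun del: poly_diff)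
  have "(\<lambda>n. peval (p n - q n) a) \<longlonglongrightarrow> 0"
  proof (rule tendstoI)
    fix e :: real assume e: "e > 0"
    have "\<forall>\<^sub>F n in sequentially. \<forall>z\<in>spectrum a. dist (poly (p n - q n) z) 0 < e / 2"
      using uniform_limitD [OF u, of "e / 2"] e by simp
    then show "\<forall>\<^sub>F n in sequentially. dist (peval (p n - q n) a) 0 < e"
    proof eventually_elim
      case (elim n)
      then have "norm (peval (p n - q n) a) \<le> e / 2"
        using norm_peval_le [OF assms(1,2), of "p n - q n" "e / 2"] by (simp add: less_imp_le)
      then show ?case using e by simp
    qed
  qed
  moreover have "(\<lambda>n. peval (p n - q n) a) \<longlonglongrightarrow> x - y"
    using tendsto_diff [OF p(2) q(2)] by simp
  ultimately show ?thesis using LIMSEQ_unique by fastforce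
qed

text \<open>\<open>Re\<close> carries \<open>S\<close> to a compact set of reals, where
  Stone-Weierstrass applies; the real coefficients found there define a complex polynomial.\<close>

lemma polynomial_approximation_real:
  fixes h :: "complex \<Rightarrow> real"
  assumes S: "compact S" "S \<subseteq> \<real>" and h: "continuous_on S h" and e: "e > 0"
  shows "\<exists>p. \<forall>z\<in>S. cmod (poly p z - of_real (h z)) < e"
proof -
  have rz: "of_real (Re z) = z" if "z \<in> S" for z
    using subsetD [OF S(2) that] by (rule of_real_Re)
  then have sub: "(of_real ` Re ` S :: complex set) \<subseteq> S"
    by (simp add: image_subset_iff)
  have "compact (Re ` S)"
    by (intro compact_continuous_image continuous_intros S)
  moreover have "continuous_on (Re ` S) (\<lambda>t. h (of_real t))"
    by (intro continuous_on_compose2 [OF h] continuous_intros sub)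
  ultimately obtain g where g: "real_polynomial_function g"
      "\<And>t. t \<in> Re ` S \<Longrightarrow> \<bar>h (of_real t) - g t\<bar> < e"
    using Stone_Weierstrass_real_polynomial_function [OF _ _ e] by metis
  then obtain c n where c: "g = (\<lambda>t. \<Sum>i\<le>n. c i * t ^ i)"
    using real_polynomial_function_iff_sum by blast
  define p where "p = (\<Sum>i\<le>n. monom (complex_of_real (c i)) i)"
  have "cmod (poly p z - of_real (h z)) < e" if z: "z \<in> S" for z
  proof -
    have "poly p (of_real (Re z)) = of_real (g (Re z))"
      by (simp add: p_def c poly_sum poly_monom)
    then have "poly p z - of_real (h z) = of_real (g (Re z) - h z)"
      by (simp only: rz [OF z] of_real_diff)
    then have "cmod (poly p z - of_real (h z)) = \<bar>h (of_real (Re z)) - g (Re z)\<bar>"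
      by (simp only: norm_of_real abs_minus_commute rz [OF z])
    then show ?thesis using g(2) z by simp
  qed
  then show ?thesis by blast
qed

lemma polynomial_approximation:
  fixes h :: "complex \<Rightarrow> complex"
  assumes S: "compact S" "S \<subseteq> \<real>" and h: "continuous_on S h"
  obtains p where "uniform_limit S (\<lambda>n. poly (p n)) h sequentially"
proof -
  have ex: "\<exists>p. \<forall>z\<in>S. cmod (poly p z - h z) < e" if e: "e > 0" for e
  proof -
    have "e / 2 > 0" using e by simp
    note approx = polynomial_approximation_real [OF S _ this]
    obtain p q where pq: "\<And>z. z \<in> S \<Longrightarrow> cmod (poly p z - of_real (Re (h z))) < e / 2"
       "\<And>z. z \<in> S \<Longrightarrow> cmod (poly q z - of_real (Im (h z))) < e / 2"
      using approx [OF continuous_on_Re [OF h]] approx [OF continuous_on_Im [OF h]] by blast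
    have "cmod (poly (p + smult \<i> q) z - h z) < e" if z: "z \<in> S" for z
    proof -
      have "poly (p + smult \<i> q) z - h z =
        (poly p z - of_real (Re (h z))) + \<i> * (poly q z - of_real (Im (h z)))"
        by (subst (3) complex_eq) (simp add: algebra_simps)
      also have "cmod \<dots> \<le> cmod (poly p z - of_real (Re (h z))) + cmod (\<i> * (poly q z - of_real (Im (h z))))"
        by (rule norm_triangle_ineq)
      finally show ?thesis using pq [OF z] by (simp add: norm_mult)
    qed
    then show ?thesis by blast
  qed
  have "\<forall>n. \<exists>p. \<forall>z\<in>S. cmod (poly p z - h z) < inverse (real (Suc n))"
    using ex by simp
  then obtain p where p: "\<And>n z. z \<in> S \<Longrightarrow> cmod (poly (p n) z - h z) < inverse (real (Suc n))"
    by metis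
  have "uniform_limit S (\<lambda>n. poly (p n)) h sequentially"
  proof (rule uniform_limitI)
    fix e :: real assume "e > 0"
    then obtain N where N: "inverse (real (Suc N)) < e" using reals_Archimedean by blast
    show "\<forall>\<^sub>F n in sequentially. \<forall>z\<in>S. dist (poly (p n) z) (h z) < e"
      unfolding eventually_sequentially
    proof (intro exI allI impI ballI)
      fix n z assume "N \<le> n" "z \<in> S"
      then have "inverse (real (Suc n)) \<le> inverse (real (Suc N))" by simp
      then show "dist (poly (p n) z) (h z) < e"
        using p [OF \<open>z \<in> S\<close>, of n] N unfolding dist_norm by linarith
    qed
  qed
  then show thesis by (rule that)
qed

text \<open>By \<open>norm_peval_le\<close> a uniformly Cauchy sequence of polynomials becomes a
  norm Cauchy sequence, which converges by completeness.\<close>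

lemma calculus_graph_exists:
  fixes a :: "'a::cstar_algebra"
  assumes "selfadjoint a" "spectrum a \<subseteq> \<real>" "continuous_on (spectrum a) f"
  shows "\<exists>x. calculus_graph a f x"
proof -
  obtain p where p: "uniform_limit (spectrum a) (\<lambda>n. poly (p n)) f sequentially"
    using polynomial_approximation [OF compact_spectrum assms(2,3)] by blast
  have "Cauchy (\<lambda>n. peval (p n) a)"
  proof (rule metric_CauchyI)
    fix e :: real assume e: "e > 0"
    have "uniformly_Cauchy_on (spectrum a) (\<lambda>n. poly (p n))"
      using p uniformly_convergent_Cauchy uniformly_convergent_on_def by blast
    then obtain M where M: "\<And>m n z. z \<in> spectrum a \<Longrightarrow> M \<le> m \<Longrightarrow> M \<le> n \<Longrightarrow>
        dist (poly (p m) z) (poly (p n) z) < e / 2"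
      unfolding uniformly_Cauchy_on_def using e by (meson half_gt_zero)
    have "dist (peval (p m) a) (peval (p n) a) < e" if "M \<le> m" "M \<le> n" for m n
    proof -
      have "norm (peval (p m - p n) a) \<le> e / 2"
        using M [OF _ that] by (intro norm_peval_le assms) (simp add: dist_norm less_imp_le)
      then show ?thesis using e by (simp add: dist_norm)
    qed
    then show "\<exists>M. \<forall>m\<ge>M. \<forall>n\<ge>M. dist (peval (p m) a) (peval (p n) a) < e" by blast
  qed
  then show ?thesis using p by (auto simp: calculus_graph_def Cauchy_convergent_iff convergent_def)
qed

lemma calculus_graph_poly: "calculus_graph a (poly p) (peval p a)"
  unfolding calculus_graph_def by (intro exI [of _ "\<lambda>_. p"]) (simp add: uniform_limit_const)

lemma calculus_graph_cong:
  assumes "calculus_graph a f x" "\<And>z. z \<in> spectrum a \<Longrightarrow> f z = g z"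
  shows "calculus_graph a g x"
  using assms uniform_limit_cong' [of "spectrum a" "\<lambda>n. poly (p n)" "\<lambda>n. poly (p n)" f g sequentially for p]
  by (auto simp: calculus_graph_def)

lemma calculus_graph_add:
  assumes "calculus_graph a f x" "calculus_graph a g y"
  shows "calculus_graph a (\<lambda>z. f z + g z) (x + y)"
proof -
  obtain p q where
    p: "uniform_limit (spectrum a) (\<lambda>n. poly (p n)) f sequentially" "(\<lambda>n. peval (p n) a) \<longlonglongrightarrow> x" and
    q: "uniform_limit (spectrum a) (\<lambda>n. poly (q n)) g sequentially" "(\<lambda>n. peval (q n) a) \<longlonglongrightarrow> y"
    using assms by (auto simp: calculus_graph_def)
  show ?thesis unfolding calculus_graph_def
    using uniform_limit_add [OF p(1) q(1)] tendsto_add [OF p(2) q(2)]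
    by (intro exI [of _ "\<lambda>n. p n + q n"]) (simp add: poly_add_fun del: poly_add)
qed

lemma calculus_graph_mult:
  assumes "continuous_on (spectrum a) f" "continuous_on (spectrum a) g"
    and "calculus_graph a f x" "calculus_graph a g y"
  shows "calculus_graph a (\<lambda>z. f z * g z) (x * y)"
proof -
  obtain p q where
    p: "uniform_limit (spectrum a) (\<lambda>n. poly (p n)) f sequentially" "(\<lambda>n. peval (p n) a) \<longlonglongrightarrow> x" and
    q: "uniform_limit (spectrum a) (\<lambda>n. poly (q n)) g sequentially" "(\<lambda>n. peval (q n) a) \<longlonglongrightarrow> y"
    using assms by (auto simp: calculus_graph_def)
  \<comment> \<open>Products of uniform limits converge uniformly when the limits are bounded;
    continuity on the compact spectrum provides this.\<close>
  have "bounded (f ` spectrum a)" "bounded (g ` spectrum a)"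
    using assms compact_spectrum by (auto intro: compact_imp_bounded compact_continuous_image)
  from uniform_lim_mult [OF p(1) q(1) this] tendsto_mult [OF p(2) q(2)]
  show ?thesis unfolding calculus_graph_def
    by (intro exI [of _ "\<lambda>n. p n * q n"]) (simp add: poly_mult_fun del: poly_mult)
qed

lemma calculus_graph_scaleC:
  assumes "calculus_graph a f x"
  shows "calculus_graph a (\<lambda>z. c * f z) (c *\<^sub>C x)"
proof -
  obtain p where
    p: "uniform_limit (spectrum a) (\<lambda>n. poly (p n)) f sequentially" "(\<lambda>n. peval (p n) a) \<longlonglongrightarrow> x"
    using assms by (auto simp: calculus_graph_def)
  show ?thesis unfolding calculus_graph_def
    using bounded_linear.uniform_limit [OF bounded_linear_mult_right p(1), of c]
      bounded_linear.tendsto [OF bounded_linear_scaleC p(2), of c]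
    by (intro exI [of _ "\<lambda>n. smult c (p n)"]) (simp add: poly_smult_fun del: poly_smult)
qed

lemma calculus_graph_star:
  assumes "selfadjoint a" "spectrum a \<subseteq> \<real>" "calculus_graph a f x"
  shows "calculus_graph a (\<lambda>z. cnj (f z)) (star x)"
proof -
  obtain p where
    p: "uniform_limit (spectrum a) (\<lambda>n. poly (p n)) f sequentially" "(\<lambda>n. peval (p n) a) \<longlonglongrightarrow> x"
    using assms by (auto simp: calculus_graph_def)
  have "uniform_limit (spectrum a) (\<lambda>n z. cnj (poly (p n) z)) (\<lambda>z. cnj (f z)) sequentially"
    by (rule bounded_linear.uniform_limit [OF bounded_linear_cnj p(1)])
  moreover have "cnj (poly q z) = poly (map_poly cnj q) z" if "z \<in> spectrum a" for q z
    using poly_map_poly_cnj that assms(2) by (metis subsetD)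
  ultimately have "uniform_limit (spectrum a) (\<lambda>n. poly (map_poly cnj (p n))) (\<lambda>z. cnj (f z)) sequentially"
    by (rule uniform_limit_cong'[THEN iffD1, rotated 2]) auto
  then show ?thesis unfolding calculus_graph_def
    using bounded_linear.tendsto [OF bounded_linear_star p(2)] star_peval [OF assms(1)]
    by (intro exI [of _ "\<lambda>n. map_poly cnj (p n)"]) simp
qed

section \<open>Star-homomorphisms from continuous functions and uniqueness of the calculus\<close>

locale star_hom_C =
  fixes S :: "complex set" and \<Phi> :: "(complex \<Rightarrow> complex) \<Rightarrow> 'a::cstar_algebra"
  assumes hom: "unital_star_hom_on S \<Phi>"
begin

lemma cong: "continuous_on S f \<Longrightarrow> continuous_on S g \<Longrightarrow> (\<And>z. z \<in> S \<Longrightarrow> f z = g z) \<Longrightarrow> \<Phi> f = \<Phi> g"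
  using hom unfolding unital_star_hom_on_def by blast

lemma add: "continuous_on S f \<Longrightarrow> continuous_on S g \<Longrightarrow> \<Phi> (\<lambda>z. f z + g z) = \<Phi> f + \<Phi> g"
  using hom unfolding unital_star_hom_on_def by blast

lemma scale: "continuous_on S f \<Longrightarrow> \<Phi> (\<lambda>z. c * f z) = c *\<^sub>C \<Phi> f"
  using hom unfolding unital_star_hom_on_def by blast

lemma mult: "continuous_on S f \<Longrightarrow> continuous_on S g \<Longrightarrow> \<Phi> (\<lambda>z. f z * g z) = \<Phi> f * \<Phi> g"
  using hom unfolding unital_star_hom_on_def by blast

lemma star: "continuous_on S f \<Longrightarrow> \<Phi> (\<lambda>z. cnj (f z)) = star (\<Phi> f)"
  using hom unfolding unital_star_hom_on_def by blast

lemma one: "\<Phi> (\<lambda>z. 1) = 1"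
  using hom unfolding unital_star_hom_on_def by blast

lemma const: "\<Phi> (\<lambda>z. c) = c *\<^sub>C 1"
  using scale [of "\<lambda>z. 1" c] one by simp

lemma diff:
  assumes "continuous_on S f" "continuous_on S g"
  shows "\<Phi> (\<lambda>z. f z - g z) = \<Phi> f - \<Phi> g"
  using add [OF assms(1) continuous_on_minus [OF assms(2)]] scale [OF assms(2), of "- 1"] by simp

text \<open>If \<open>f\<close> omits the value \<open>w\<close> on \<open>S\<close>, then
  \<open>1 / (f - w)\<close> is continuous there and its image inverts
  \<open>\<Phi> f - w\<close>.\<close>

lemma spectrum_image:
  assumes "continuous_on S f"
  shows "spectrum (\<Phi> f) \<subseteq> f ` S"
proof (rule subsetI, rule ccontr)
  fix w assume w: "w \<in> spectrum (\<Phi> f)" "w \<notin> f ` S"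
  let ?g = "\<lambda>z. f z - w" and ?h = "\<lambda>z. inverse (f z - w)"
  have g: "continuous_on S ?g" and h: "continuous_on S ?h"
    using w assms by (auto intro!: continuous_intros)
  have "\<Phi> (\<lambda>z. ?g z * ?h z) = 1" "\<Phi> (\<lambda>z. ?h z * ?g z) = 1"
    unfolding one [symmetric] using w
    by (auto intro!: cong continuous_on_mult g h) (auto simp: image_def)
  moreover have "\<Phi> ?g = \<Phi> f - w *\<^sub>C 1"
    using diff [OF assms continuous_on_const] const by simp
  ultimately have "mutual_inverse (\<Phi> f - w *\<^sub>C 1) (\<Phi> ?h)"
    by (simp add: mult [OF g h] mult [OF h g] mutual_inverse_def)
  then show False using w notin_spectrum_iff by blast
qed

text \<open>As for polynomials, the spectral bound is applied to the self-adjoint image of the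
  squared modulus of \<open>f\<close>.\<close>

lemma contractive:
  assumes f: "continuous_on S f" and r: "0 \<le> r" "\<And>z. z \<in> S \<Longrightarrow> cmod (f z) \<le> r"
  shows "norm (\<Phi> f) \<le> r"
proof -
  let ?q = "\<lambda>z. cnj (f z) * f z"
  have cf: "continuous_on S (\<lambda>z. cnj (f z))" by (intro continuous_intros f)
  have q: "\<Phi> ?q = star (\<Phi> f) * \<Phi> f"
    by (simp add: mult cf f star)
  have "norm (\<Phi> ?q) \<le> r\<^sup>2"
  proof (rule norm_le_spectral_bound)
    show "selfadjoint (\<Phi> ?q)" by (simp only: q selfadjoint_def star_mult star_star)
    fix z assume "z \<in> spectrum (\<Phi> ?q)"
    then obtain w where w: "w \<in> S" "z = ?q w"
      using spectrum_image [OF continuous_on_mult [OF cf f]] by blast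
    then have "cmod z = (cmod (f w))\<^sup>2" by (simp add: norm_mult power2_eq_square)
    also have "\<dots> \<le> r\<^sup>2" using r w(1) by (intro power_mono) auto
    finally show "cmod z \<le> r\<^sup>2" .
  qed simp
  then show ?thesis
    using r(1) unfolding q cstar_identity by (simp add: power2_le_iff_abs_le)
qed

lemma poly: "\<Phi> (\<lambda>z. z) = a \<Longrightarrow> \<Phi> (poly p) = peval p a"
proof (induction p)
  case 0
  then show ?case using const [of 0] by simp
next
  case (pCons c p)
  then show ?case
    using add [of "\<lambda>z. c" "\<lambda>z. z * poly p z"] mult [of "\<lambda>z. z" "poly p"] const [of c]
    by (simp add: continuous_intros)
qed

end

text \<open>\<open>\<Phi>\<close> agrees with \<open>peval\<close> on polynomials and is
  contractive, so it preserves uniform limits. Together with \<open>calculus_graph_unique\<close>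
  this makes the description in \<open>cfc\<close> single-valued.\<close>

lemma star_hom_calculus_graph:
  fixes a :: "'a::cstar_algebra"
  assumes "selfadjoint a" "spectrum a \<subseteq> \<real>" "continuous_on (spectrum a) f"
    and hom: "unital_star_hom_on (spectrum a) \<Phi>" and id: "\<Phi> (\<lambda>z. z) = a"
  shows "calculus_graph a f (\<Phi> f)"
proof -
  interpret star_hom_C "spectrum a" \<Phi> by unfold_locales (rule hom)
  obtain p where p: "uniform_limit (spectrum a) (\<lambda>n. poly (p n)) f sequentially"
    using polynomial_approximation [OF compact_spectrum assms(2,3)] by blast
  have "(\<lambda>n. peval (p n) a) \<longlonglongrightarrow> \<Phi> f"
  proof (rule tendstoI)
    fix e :: real assume e: "e > 0"
    have "\<forall>\<^sub>F n in sequentially. \<forall>z\<in>spectrum a. dist (poly (p n) z) (f z) < e / 2"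
      using uniform_limitD [OF p, of "e / 2"] e by simp
    then show "\<forall>\<^sub>F n in sequentially. dist (peval (p n) a) (\<Phi> f) < e"
    proof eventually_elim
      case (elim n)
      have "norm (\<Phi> (\<lambda>z. poly (p n) z - f z)) \<le> e / 2"
        using elim e by (intro contractive continuous_intros assms) (auto simp: dist_norm less_imp_le)
      then show ?case
        using e by (simp add: diff assms(3) continuous_intros dist_norm poly [OF id])
    qed
  qed
  with p show ?thesis by (auto simp: calculus_graph_def)
qed

lemma cfc_star_hom:
  fixes a :: "'a::cstar_algebra"
  assumes "selfadjoint a" "spectrum a \<subseteq> \<real>"
  obtains \<Phi> where "unital_star_hom_on (spectrum a) \<Phi>"
    "\<And>f. continuous_on (spectrum a) f \<Longrightarrow> cfc f a = \<Phi> f"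
proof -
  define \<Phi> where "\<Phi> f = (THE x. calculus_graph a f x)" for f
  have eq: "\<Phi> f = x" if "calculus_graph a f x" for f x
    unfolding \<Phi>_def using that calculus_graph_unique [OF assms] by (blast intro: the_equality)
  have gr: "calculus_graph a f (\<Phi> f)" if "continuous_on (spectrum a) f" for f
    using calculus_graph_exists [OF assms that] eq by blast
  have poly_one: "poly 1 = (\<lambda>z::complex. 1)" and poly_X: "poly [:0, 1:] = (\<lambda>z::complex. z)"
    by (auto simp: fun_eq_iff)
  \<comment> \<open>Through \<open>eq\<close> each homomorphism law becomes a closure property of
    \<open>calculus_graph\<close>.\<close>
  have hom: "unital_star_hom_on (spectrum a) \<Phi>"
    unfolding unital_star_hom_on_def
  proof (intro conjI allI impI)
    show "\<Phi> (\<lambda>z. 1) = 1"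
      using eq [OF calculus_graph_poly [of a 1]] poly_one by simp
  qed (auto intro!: eq intro: gr calculus_graph_cong calculus_graph_add calculus_graph_scaleC
      calculus_graph_mult calculus_graph_star [OF assms])
  have id: "\<Phi> (\<lambda>z. z) = a"
    using eq [OF calculus_graph_poly [of a "[:0, 1:]"]] poly_X by simp
  have "cfc f a = \<Phi> f" if f: "continuous_on (spectrum a) f" for f
    unfolding cfc_def
  proof (rule the_equality)
    show "\<exists>\<Psi>. unital_star_hom_on (spectrum a) \<Psi> \<and> \<Psi> (\<lambda>z. z) = a \<and> \<Psi> f = \<Phi> f"
      using hom id by blast
  qed (use eq star_hom_calculus_graph [OF assms f] in metis)
  with hom show thesis by (rule that)
qed

context
  fixes a :: "'a::cstar_algebra"
  assumes a: "selfadjoint a" "spectrum a \<subseteq> \<real>"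
begin

lemma real_cfc_const: "real_cfc (\<lambda>t. c) a = of_real c *\<^sub>C 1"
proof -
  obtain \<Phi> where hom: "unital_star_hom_on (spectrum a) \<Phi>"
    and cfc: "\<And>f. continuous_on (spectrum a) f \<Longrightarrow> cfc f a = \<Phi> f"
    using cfc_star_hom [OF a] by blast
  interpret star_hom_C "spectrum a" \<Phi> by unfold_locales (rule hom)
  show ?thesis using const cfc by (simp add: real_cfc_def)
qed

lemma
  assumes f: "continuous_on (spectrum a) (\<lambda>z. f (Re z))"
    and g: "continuous_on (spectrum a) (\<lambda>z. g (Re z))"
  shows real_cfc_add: "real_cfc (\<lambda>t. f t + g t) a = real_cfc f a + real_cfc g a"
    and real_cfc_mult: "real_cfc (\<lambda>t. f t * g t) a = real_cfc f a * real_cfc g a"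
proof -
  obtain \<Phi> where hom: "unital_star_hom_on (spectrum a) \<Phi>"
    and cfc: "\<And>f. continuous_on (spectrum a) f \<Longrightarrow> cfc f a = \<Phi> f"
    using cfc_star_hom [OF a] by blast
  interpret star_hom_C "spectrum a" \<Phi> by unfold_locales (rule hom)
  have c: "continuous_on (spectrum a) (\<lambda>z. complex_of_real (f (Re z)))"
     "continuous_on (spectrum a) (\<lambda>z. complex_of_real (g (Re z)))"
    by (intro continuous_intros f g)+
  show "real_cfc (\<lambda>t. f t + g t) a = real_cfc f a + real_cfc g a"
    using add [OF c] cfc continuous_on_add [OF c] c by (simp add: real_cfc_def)
  show "real_cfc (\<lambda>t. f t * g t) a = real_cfc f a * real_cfc g a"
    using mult [OF c] cfc continuous_on_mult [OF c] c by (simp add: real_cfc_def)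
qed

end

subsection \<open>States on the functional calculus\<close>

lemma state_nonneg:
  fixes \<tau> :: "'a::cstar_algebra \<Rightarrow> complex"
  assumes \<tau>: "state \<tau>" and a: "selfadjoint a" "spectrum a \<subseteq> \<real>"
    and h: "continuous_on (spectrum a) (\<lambda>z. h (Re z))" "\<And>z. z \<in> spectrum a \<Longrightarrow> 0 \<le> h (Re z)"
  shows "0 \<le> \<tau> (real_cfc h a)"
proof -
  obtain \<Phi> where hom: "unital_star_hom_on (spectrum a) \<Phi>"
    and cfc: "\<And>f. continuous_on (spectrum a) f \<Longrightarrow> cfc f a = \<Phi> f"
    using cfc_star_hom [OF a] by blast
  interpret star_hom_C "spectrum a" \<Phi> by unfold_locales (rule hom)
  \<comment> \<open>The square root turns the image of \<open>h\<close> into the form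
    \<open>star x * x\<close>, on which states are nonnegative.\<close>
  let ?k = "\<lambda>z. complex_of_real (sqrt (h (Re z)))"
  have k: "continuous_on (spectrum a) ?k" by (intro continuous_intros h)
  have "real_cfc h a = \<Phi> (\<lambda>z. of_real (h (Re z)))"
    unfolding real_cfc_def by (intro cfc continuous_intros h)
  also have "\<dots> = \<Phi> (\<lambda>z. cnj (?k z) * ?k z)"
    using h(2) by (intro cong continuous_intros h k) (auto simp flip: of_real_mult)
  also have "\<dots> = star (\<Phi> ?k) * \<Phi> ?k"
    using mult [of "\<lambda>z. cnj (?k z)" ?k] star [OF k] k by (auto intro: continuous_intros)
  finally show ?thesis using \<tau> by (simp add: state_def)
qed

text \<open>The coefficients are left free to serve both states: for the first the expression is an
  expanded product of differences, for the second it need not factor.\<close>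

lemma state_real_cfc_nonneg:
  fixes \<tau> :: "'a::cstar_algebra \<Rightarrow> complex" and \<alpha> \<beta> \<gamma> :: real
  assumes \<tau>: "state \<tau>" and a: "selfadjoint a" "spectrum a \<subseteq> \<real>"
    and f: "continuous_on (spectrum a) (\<lambda>z. f (Re z))"
    and g: "continuous_on (spectrum a) (\<lambda>z. g (Re z))"
    and nonneg: "\<And>z. z \<in> spectrum a \<Longrightarrow> 0 \<le> f (Re z) * g (Re z) + \<alpha> * f (Re z) + \<beta> * g (Re z) + \<gamma>"
  shows "0 \<le> \<tau> (real_cfc f a * real_cfc g a) + \<alpha> * \<tau> (real_cfc f a) + \<beta> * \<tau> (real_cfc g a) + \<gamma>"
proof -
  have c: "continuous_on (spectrum a) (\<lambda>z. f (Re z) * g (Re z))"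
    "continuous_on (spectrum a) (\<lambda>z. \<alpha> * f (Re z))" "continuous_on (spectrum a) (\<lambda>z. \<beta> * g (Re z))"
    "continuous_on (spectrum a) (\<lambda>z. \<gamma>)" "continuous_on (spectrum a) (\<lambda>z. \<alpha>)"
    "continuous_on (spectrum a) (\<lambda>z. \<beta>)"
    by (intro continuous_intros f g)+
  let ?h = "\<lambda>t. f t * g t + \<alpha> * f t + \<beta> * g t + \<gamma>"
  note add = real_cfc_add [OF a] and mult = real_cfc_mult [OF a] and const = real_cfc_const [OF a]
  have "real_cfc ?h a = real_cfc f a * real_cfc g a + (of_real \<alpha> *\<^sub>C 1) * real_cfc f a
      + (of_real \<beta> *\<^sub>C 1) * real_cfc g a + of_real \<gamma> *\<^sub>C 1"
    by (simp only: add mult const c f g continuous_on_add continuous_on_mult)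
  moreover have "0 \<le> \<tau> (real_cfc ?h a)"
    by (rule state_nonneg [OF \<tau> a]) (intro continuous_intros f g nonneg | assumption)+
  ultimately show ?thesis
    using \<tau> by (simp add: state_def mult_scaleC_left)
qed

text \<open>\<open>f\<close> is the difference of the nonnegative functions
  \<open>f + \<bar>f\<bar>\<close> and \<open>\<bar>f\<bar>\<close>, on which the state is
  real.\<close>

lemma state_real_cfc_real:
  fixes \<tau> :: "'a::cstar_algebra \<Rightarrow> complex"
  assumes \<tau>: "state \<tau>" and a: "selfadjoint a" "spectrum a \<subseteq> \<real>"
    and f: "continuous_on (spectrum a) (\<lambda>z. f (Re z))"
  shows "Im (\<tau> (real_cfc f a)) = 0"
proof -
  have g: "continuous_on (spectrum a) (\<lambda>z. \<bar>f (Re z)\<bar>)"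
    by (intro continuous_intros f)
  have "0 \<le> \<tau> (real_cfc (\<lambda>t. \<bar>f t\<bar>) a)"
    by (rule state_nonneg [OF \<tau> a g]) simp
  moreover have "0 \<le> \<tau> (real_cfc (\<lambda>t. f t + \<bar>f t\<bar>) a)"
    by (rule state_nonneg [OF \<tau> a]) (use continuous_on_add [OF f g] in auto)
  moreover have "\<tau> (real_cfc (\<lambda>t. f t + \<bar>f t\<bar>) a) = \<tau> (real_cfc f a) + \<tau> (real_cfc (\<lambda>t. \<bar>f t\<bar>) a)"
    using \<tau> real_cfc_add [OF a f g] by (simp add: state_def)
  ultimately show ?thesis by (simp add: less_eq_complex_def)
qed

theorem theorem4p1:
  fixes \<tau>\<^sub>1 \<tau>\<^sub>2 :: "'a::cstar_algebra \<Rightarrow> complex"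
    and J :: "real set"
    and f g :: "real \<Rightarrow> real"
    and A B :: 'a
  assumes "state \<tau>\<^sub>1" and "state \<tau>\<^sub>2"
    and "is_interval J"
    and "synchronous_on J f g"
    and "selfadjoint A" and "selfadjoint B"
    and "spectrum A \<subseteq> complex_of_real ` J" and "spectrum B \<subseteq> complex_of_real ` J"
  shows "\<tau>\<^sub>1 (real_cfc f A * real_cfc g A) + \<tau>\<^sub>2 (real_cfc f B * real_cfc g B)
    \<ge> \<tau>\<^sub>1 (real_cfc f A) * \<tau>\<^sub>2 (real_cfc g B) + \<tau>\<^sub>2 (real_cfc f B) * \<tau>\<^sub>1 (real_cfc g A)"
proof -
  have sync: "continuous_on J f" "continuous_on J g"
    "\<And>s t. s \<in> J \<Longrightarrow> t \<in> J \<Longrightarrow> 0 \<le> (f t - f s) * (g t - g s)"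
    using assms(4) by (auto simp: synchronous_on_def)
  have spec: "spectrum A \<subseteq> \<real>" "spectrum B \<subseteq> \<real>"
    and J: "\<And>z. z \<in> spectrum A \<Longrightarrow> Re z \<in> J" "\<And>z. z \<in> spectrum B \<Longrightarrow> Re z \<in> J"
    using assms(7,8) by auto
  have cA: "continuous_on (spectrum A) (\<lambda>z. f (Re z))" "continuous_on (spectrum A) (\<lambda>z. g (Re z))"
    using J by (auto intro!: continuous_on_compose2 [OF sync(1)] continuous_on_compose2 [OF sync(2)]
      continuous_intros)
  have cB: "continuous_on (spectrum B) (\<lambda>z. f (Re z))" "continuous_on (spectrum B) (\<lambda>z. g (Re z))"
    using J by (auto intro!: continuous_on_compose2 [OF sync(1)] continuous_on_compose2 [OF sync(2)]
      continuous_intros)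
  define F G P where "F = Re (\<tau>\<^sub>1 (real_cfc f A))" and "G = Re (\<tau>\<^sub>1 (real_cfc g A))"
    and "P = Re (\<tau>\<^sub>1 (real_cfc f A * real_cfc g A))"
  have FG: "\<tau>\<^sub>1 (real_cfc f A) = F" "\<tau>\<^sub>1 (real_cfc g A) = G"
    using state_real_cfc_real [OF assms(1,5) spec(1) cA(1)]
      state_real_cfc_real [OF assms(1,5) spec(1) cA(2)]
    by (simp_all add: F_def G_def complex_eq_iff)
  have "continuous_on (spectrum A) (\<lambda>z. f (Re z) * g (Re z))"
    by (intro continuous_intros cA)
  from state_real_cfc_real [OF assms(1,5) spec(1) this]
  have P: "\<tau>\<^sub>1 (real_cfc f A * real_cfc g A) = P"
    by (simp add: P_def complex_eq_iff real_cfc_mult [OF assms(5) spec(1) cA])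
  \<comment> \<open>Applying \<open>\<tau>\<^sub>1\<close> to \<open>(f - f s) * (g - g s)\<close>
    at \<open>A\<close> removes the first variable and leaves a real inequality in
    \<open>s\<close>.\<close>
  have "0 \<le> f s * g s + (- G) * f s + (- F) * g s + P" if s: "s \<in> J" for s
  proof -
    have "0 \<le> f (Re z) * g (Re z) + (- g s) * f (Re z) + (- f s) * g (Re z) + f s * g s"
      if "z \<in> spectrum A" for z
      using sync(3) [OF s J(1) [OF that]] by (simp add: algebra_simps)
    from state_real_cfc_nonneg [OF assms(1,5) spec(1) cA this]
    have "0 \<le> complex_of_real (P - g s * F - f s * G + f s * g s)"
      by (simp add: FG P)
    then have "0 \<le> P - g s * F - f s * G + f s * g s"
      by (simp only: less_eq_complex_def Re_complex_of_real zero_complex.sel)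
    then show ?thesis by (simp add: algebra_simps)
  qed
  \<comment> \<open>Now \<open>s\<close> runs over the spectrum of \<open>B\<close> and
    \<open>\<tau>\<^sub>2\<close> is applied, with \<open>- G\<close>, \<open>- F\<close> and
    \<open>P\<close> as constants.\<close>
  from state_real_cfc_nonneg [OF assms(2,6) spec(2) cB this [OF J(2)]]
  show ?thesis
    by (simp add: FG P less_eq_complex_def algebra_simps)
qed

end
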